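(* Let $\mathcal F$ be an inversive difference field of characteristic zero, $\mathcal I\subset\mathcal F\{\mathbb Y^\pm\}$ a Laurent binomial $\sigma$-ideal, and $L$ the support lattice of $\mathcal I$. Then the reflexive closure of $\mathcal I$ is also a Laurent binomial $\sigma$-ideal, and its support lattice is the $x$-saturation of $L$.
   Context: A difference field ($\sigma$-field) is a field $\mathcal F$ with a ring endomorphism $\sigma$ with $\sigma(a)=0$ iff $a=0$; inversive means $\sigma$ bijective. $\mathbb Y=\{y_1,\ldots,y_n\}$ are difference indeterminates. For $p=\sum_i c_ix^i\in\mathbb Z[x]$, $a^p:=\prod_i\sigma^i(a)^{c_i}$; for $\mathbf f\in\mathbb Z[x]^n$, $\mathbb Y^{\mathbf f}:=\prod_iy_i^{f_i}$. $\mathcal F\{\mathbb Y^\pm\}$ is the ring of Laurent difference polynomials (finite $\mathcal F$-linear combinations of the $\mathbb Y^{\mathbf f}$). A $\sigma$-ideal is an ideal closed under $\sigma$. A Laurent binomial $\sigma$-ideal is a $\sigma$-ideal generated by elements $a\mathbb Y^{\mathbf g}+b\mathbb Y^{\mathbf h}$, $a,b\in\mathcal F$. Its support lattice is the $\mathbb Z[x]$-module $\{\mathbf f\in\mathbb Z[x]^n\mid\exists c\in\mathcal F\setminus\{0\},\ \mathbb Y^{\mathbf f}-c\in\mathcal I\}$. A $\sigma$-ideal is reflexive if $\sigma(a)\in\mathcal I$ implies $a\in\mathcal I$; the reflexive closure is the smallest reflexive $\sigma$-ideal containing $\mathcal I$. The $x$-saturation of a $\mathbb Z[x]$-submodule $L\subset\mathbb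 Z[x]^n$ is $\mathrm{sat}_x(L)=\{\mathbf f\in\mathbb Z[x]^n\mid\exists k\in\mathbb N,\ x^k\mathbf f\in L\}$. *)

theory Defs
  imports "HOL-Analysis.Finite_Cartesian_Product" "HOL-Computational_Algebra.Polynomial"
    "HOL-Library.Poly_Mapping"
begin

locale difference_field =
  fixes \<sigma> :: "'a::field \<Rightarrow> 'a"
  assumes sigma_add: "\<sigma> (a + b) = \<sigma> a + \<sigma> b"
    and sigma_mult: "\<sigma> (a * b) = \<sigma> a * \<sigma> b"
    and sigma_one: "\<sigma> 1 = 1"
    and sigma_eq_0_iff: "\<sigma> a = 0 \<longleftrightarrow> a = 0"

locale inversive_difference_field = difference_field +
  assumes bij_sigma: "bij \<sigma>"

text \<open>
  The ring of Laurent difference polynomials over a field of type \<open>'a\<close> in the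
  difference indeterminates \<open>y\<^sub>i\<close>, with \<open>i\<close> ranging over the finite type \<open>'n\<close>, is the
  group ring of the additive group \<open>\<int>[x]\<^sup>n\<close>: the exponent \<open>f\<close> stands for the monomial
  \<open>Y\<^sup>f\<close>, and addition of exponents is multiplication of monomials. The fact
  \<open>laurent_term_indets\<close> below relates this to the formula
  \<open>Y\<^sup>f = \<Prod>\<^sub>i \<Prod>\<^sub>j \<sigma>\<^sup>j(y\<^sub>i) ^ coeff f\<^sub>i j\<close> with integer exponents.
\<close>

type_synonym ('a, 'n) laurent = "(int poly ^ 'n) \<Rightarrow>\<^sub>0 'a"

abbreviation laurent_term :: "'a::field \<Rightarrow> int poly ^ 'n \<Rightarrow> ('a, 'n::finite) laurent" where
  "laurent_term a f \<equiv> Poly_Mapping.single f a"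

abbreviation laurent_const :: "'a::field \<Rightarrow> ('a, 'n::finite) laurent" where
  "laurent_const c \<equiv> laurent_term c 0"

abbreviation xvar :: "int poly" where
  "xvar \<equiv> [:0, 1:]"

text \<open>
  The extension of the endomorphism to Laurent difference polynomials:
  \<open>\<sigma>(\<Sum> a\<^sub>f Y\<^sup>f) = \<Sum> \<sigma>(a\<^sub>f) Y\<^bsup>x f\<^esup>\<close>.
\<close>

definition laurent_sigma ::
    "('a::field \<Rightarrow> 'a) \<Rightarrow> ('a, 'n::finite) laurent \<Rightarrow> ('a, 'n) laurent" where
  "laurent_sigma \<sigma> p =
    (\<Sum>f\<in>Poly_Mapping.keys p. laurent_term (\<sigma> (Poly_Mapping.lookup p f)) (xvar *s f))"

text \<open>The ideals of a commutative ring are its submodules under multiplication.\<close>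

definition sigma_ideal :: "('a::field \<Rightarrow> 'a) \<Rightarrow> ('a, 'n::finite) laurent set \<Rightarrow> bool" where
  "sigma_ideal \<sigma> I \<longleftrightarrow> module.subspace (*) I \<and> (\<forall>p\<in>I. laurent_sigma \<sigma> p \<in> I)"

definition reflexive_sigma_ideal ::
    "('a::field \<Rightarrow> 'a) \<Rightarrow> ('a, 'n::finite) laurent set \<Rightarrow> bool" where
  "reflexive_sigma_ideal \<sigma> I \<longleftrightarrow>
    sigma_ideal \<sigma> I \<and> (\<forall>p. laurent_sigma \<sigma> p \<in> I \<longrightarrow> p \<in> I)"

definition reflexive_closure ::
    "('a::field \<Rightarrow> 'a) \<Rightarrow> ('a, 'n::finite) laurent set \<Rightarrow> ('a, 'n) laurent set" where
  "reflexive_closure \<sigma> I = reflexive_sigma_ideal \<sigma> hull I"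

definition laurent_binomials :: "('a::field, 'n::finite) laurent set" where
  "laurent_binomials = {laurent_term a g + laurent_term b h | a g b h. True}"

definition laurent_binomial_sigma_ideal ::
    "('a::field \<Rightarrow> 'a) \<Rightarrow> ('a, 'n::finite) laurent set \<Rightarrow> bool" where
  "laurent_binomial_sigma_ideal \<sigma> I \<longleftrightarrow>
    (\<exists>B \<subseteq> laurent_binomials. I = sigma_ideal \<sigma> hull B)"

definition support_lattice :: "('a::field, 'n::finite) laurent set \<Rightarrow> (int poly ^ 'n) set" where
  "support_lattice I = {f. \<exists>c. c \<noteq> 0 \<and> laurent_term 1 f - laurent_const c \<in> I}"

definition sat_x :: "(int poly ^ 'n::finite) set \<Rightarrow> (int poly ^ 'n) set" where
  "sat_x L = {f. \<exists>k::nat. xvar ^ k *s f \<in> L}"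

lemma module_mult: "module ((*) :: 'r::comm_ring_1 \<Rightarrow> 'r \<Rightarrow> 'r)"
  by unfold_locales (simp_all add: algebra_simps)

lemma sigma_ideal_Inter: "\<forall>I\<in>T. sigma_ideal \<sigma> I \<Longrightarrow> sigma_ideal \<sigma> (\<Inter>T)"
  unfolding sigma_ideal_def using module.subspace_Inter[OF module_mult, of T] by blast

lemma sigma_ideal_hull: "sigma_ideal \<sigma> (sigma_ideal \<sigma> hull B)"
  by (rule hull_in) (rule sigma_ideal_Inter)

lemma reflexive_sigma_ideal_closure: "reflexive_sigma_ideal \<sigma> (reflexive_closure \<sigma> I)"
  unfolding reflexive_closure_def
proof (rule hull_in)
  fix T :: "('a, 'b) laurent set set"
  assume "\<forall>J\<in>T. reflexive_sigma_ideal \<sigma> J"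
  then show "reflexive_sigma_ideal \<sigma> (\<Inter>T)"
    unfolding reflexive_sigma_ideal_def using sigma_ideal_Inter[of T \<sigma>] by blast
qed

context difference_field
begin

lemma laurent_sigma_term: "laurent_sigma \<sigma> (laurent_term a f) = laurent_term (\<sigma> a) (xvar *s f)"
  using sigma_eq_0_iff[of 0] by (simp add: laurent_sigma_def)

lemma xvar_smult_inj: "xvar *s f = xvar *s g \<longleftrightarrow> f = (g :: int poly ^ 'n::finite)"
  by (auto simp: vec_eq_iff)

lemma lookup_laurent_sigma:
  "Poly_Mapping.lookup (laurent_sigma \<sigma> p) (xvar *s f) = \<sigma> (Poly_Mapping.lookup p f)"
  using sigma_eq_0_iff
  by (simp add: laurent_sigma_def lookup_sum lookup_single when_def xvar_smult_inj
      in_keys_iff)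

lemma laurent_term_inverse: "laurent_term (1::'a) f * laurent_term 1 (- f) = 1"
  by (simp add: mult_single)

lemma laurent_sigma_funpow_indet:
  "(laurent_sigma \<sigma> ^^ j) (laurent_term 1 (axis i 1)) = laurent_term 1 (axis i (monom 1 j))"
proof (induction j)
  case (Suc j)
  have "xvar *s axis i (monom 1 j) = axis i (monom 1 (Suc j))"
    by (auto simp: vec_eq_iff axis_def monom_Suc)
  then show ?case
    using Suc by (simp add: laurent_sigma_term sigma_one)
qed (simp add: one_pCons monom_0)

lemma laurent_term_indets:
  fixes f :: "int poly ^ 'n::finite"
  defines "y i j \<equiv> (laurent_sigma \<sigma> ^^ j) (laurent_term 1 (axis i 1))"
  shows "laurent_term 1 f * (\<Prod>i\<in>UNIV. \<Prod>j\<le>degree (f $ i). y i j ^ nat (- coeff (f $ i) j))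
    = (\<Prod>i\<in>UNIV. \<Prod>j\<le>degree (f $ i). y i j ^ nat (coeff (f $ i) j))"
proof -
  have pow: "laurent_term (1::'a) g ^ k = laurent_term 1 (of_nat k * g)"
    for g :: "int poly ^ 'n" and k
    by (induction k) (simp_all add: mult_single algebra_simps)
  have prod: "(\<Prod>k\<in>A. laurent_term (1::'a) (g k)) = laurent_term 1 (\<Sum>k\<in>A. g k)"
    for g :: "'k \<Rightarrow> int poly ^ 'n" and A
    by (induction A rule: infinite_finite_induct) (simp_all add: mult_single)
  have comp: "(of_nat k :: int poly ^ 'n) $ i = of_nat k" for k i
    by (induction k) simp_all
  have "(\<Sum>j\<le>degree p. of_nat (nat (coeff p j)) * monom 1 j)
      = p + (\<Sum>j\<le>degree p. of_nat (nat (- coeff p j)) * monom 1 j)" for p :: "int poly"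
  proof -
    have eq: "of_nat k * monom 1 j = monom (int k) j" for k j
      by (simp add: of_nat_poly smult_monom)
    have "p = (\<Sum>j\<le>degree p. monom (coeff p j) j)"
      by (simp add: poly_as_sum_of_monoms)
    also have "\<dots> = (\<Sum>j\<le>degree p. monom (int (nat (coeff p j))) j - monom (int (nat (- coeff p j))) j)"
      by (intro sum.cong) (auto simp: diff_monom)
    also have "\<dots> = (\<Sum>j\<le>degree p. monom (int (nat (coeff p j))) j)
        - (\<Sum>j\<le>degree p. monom (int (nat (- coeff p j))) j)"
      by (rule sum_subtractf)
    finally show ?thesis
      unfolding eq by (rule eq_diff_eq[THEN iffD1, symmetric])
  qed
  note key = this
  define S where "S h = (\<Sum>i\<in>UNIV. \<Sum>j\<le>degree (f $ i). of_nat (h i j) * axis i (monom 1 j) :: int poly ^ 'n)"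
    for h :: "'n \<Rightarrow> nat \<Rightarrow> nat"
  have vec: "S h $ l = (\<Sum>j\<le>degree (f $ l). of_nat (h l j) * monom 1 j)"
    for h l
  proof -
    have "S h $ l = (\<Sum>i\<in>UNIV. \<Sum>j\<le>degree (f $ i). of_nat (h i j) * axis i (monom 1 j) $ l)"
      by (simp add: S_def comp)
    also have "\<dots> = (\<Sum>i\<in>UNIV. if l = i
        then \<Sum>j\<le>degree (f $ i). of_nat (h i j) * monom 1 j else 0)"
      by (intro sum.cong) (auto simp: axis_def)
    finally show ?thesis
      by (simp only: sum.delta' finite UNIV_I if_True)
  qed
  have "f + S (\<lambda>i j. nat (- coeff (f $ i) j)) = S (\<lambda>i j. nat (coeff (f $ i) j))"
    unfolding vec_eq_iff vector_add_component vec by (intro allI key[symmetric])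
  then show ?thesis
    unfolding y_def laurent_sigma_funpow_indet pow prod S_def mult_single mult_1_left by simp
qed

end

end

theory Submission
  imports Defs
begin

text \<open>
  The reflexive closure of a \<open>\<sigma>\<close>-ideal \<open>I\<close> is the set of all \<open>p\<close> with \<open>\<sigma>\<^sup>k(p) \<in> I\<close> for
  some \<open>k\<close>. Indeed \<open>I\<close> is closed under \<open>\<sigma>\<close>, so the preimages of \<open>I\<close> under the powers of
  \<open>\<sigma>\<close> increase with \<open>k\<close>, and their union is a reflexive \<open>\<sigma>\<close>-ideal that every other one
  containing \<open>I\<close> must contain (\<open>reflexive_closure_eq\<close>).

  The statement on support lattices follows at once: \<open>\<sigma>\<^sup>k(Y\<^sup>f - c)\<close> is the binomial with
  exponent \<open>x\<^sup>k f\<close> and constant \<open>\<sigma>\<^sup>k(c)\<close>, and over an inversive field every nonzero constant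
  is of the form \<open>\<sigma>\<^sup>k(c)\<close> with \<open>c \<noteq> 0\<close>.

  That the closure is again generated by binomials is a matter of linear algebra. A
  binomial \<open>\<sigma>\<close>-ideal is spanned, as a vector space over the coefficient field, by the
  binomials it contains, because monomial multiples and \<open>\<sigma>\<close>-images of binomials are
  binomials (\<open>binomial_sigma_ideal_spanned\<close>). The point is that this property passes from a
  subspace \<open>V\<close> to its preimage under \<open>\<sigma>\<close> (\<open>vimage_laurent_sigma_spanned\<close>). If \<open>\<sigma>(p) \<in> V\<close>, then
  \<open>\<sigma>(p)\<close> is a combination of binomials in \<open>V\<close>, but those may involve exponents outside
  \<open>x \<int>[x]\<^sup>n\<close>. Gaussian elimination removes such exponents one by one: cancelling the
  monomial \<open>Y\<^sup>t\<close> between two binomials leaves a binomial (\<open>eliminate_exponent\<close>,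
  \<open>span_binomials_supported\<close>). Binomials with all exponents in \<open>x \<int>[x]\<^sup>n\<close> are \<open>\<sigma>\<close>-images of
  binomials since \<open>\<sigma>\<close> is onto on coefficients, and \<open>\<sigma>\<close> is injective, so \<open>p\<close> is a combination
  of binomials in the preimage of \<open>V\<close>. Induction on \<open>k\<close> then covers the whole closure.
\<close>

section \<open>Laurent difference polynomials as a vector space\<close>

lemma lookup_const_mult [simp]:
  "Poly_Mapping.lookup (laurent_const c * p) f = c * Poly_Mapping.lookup p f"
  for p :: "('a::field, 'n::finite) laurent"
  unfolding mult_map_scale_conv_mult[symmetric] by (simp add: map.rep_eq when_def)

interpretation laurent: vector_space "\<lambda>c (p :: ('a::field, 'n::finite) laurent). laurent_const c * p"
  by unfold_locales (auto intro!: poly_mapping_eqI simp: lookup_add distrib_left distrib_right mult.assoc)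

lemma laurent_eq_sum_terms:
  "p = (\<Sum>f\<in>Poly_Mapping.keys p. laurent_term (Poly_Mapping.lookup p f) f)"
  for p :: "('a::field, 'n::finite) laurent"
  by (rule poly_mapping_eqI) (simp add: lookup_sum lookup_single when_def in_keys_iff)

lemma laurent_induct [case_names monomial add]:
  fixes p :: "('a::field, 'n::finite) laurent"
  assumes monomial: "\<And>a f. P (laurent_term a f)"
    and add: "\<And>p q. P p \<Longrightarrow> P q \<Longrightarrow> P (p + q)"
  shows "P p"
proof -
  have "P (\<Sum>f\<in>A. laurent_term (Poly_Mapping.lookup p f) f)" if "finite A" for A
    using that
  proof induction
    case empty
    show ?case using monomial[of 0 0] by simp
  qed (simp add: monomial add)
  from this[of "Poly_Mapping.keys p"] show ?thesis
    by (simp flip: laurent_eq_sum_terms)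
qed

lemma sigma_ideal_subspace: "sigma_ideal \<sigma> I \<Longrightarrow> laurent.subspace I"
  unfolding sigma_ideal_def module.subspace_def[OF module_mult] laurent.subspace_def by blast

section \<open>Spaces spanned by binomials\<close>

text \<open>
  Counting exponents characterises binomials independently of a choice of representation
  (zero, monomials and coinciding exponents included). In this form they are visibly
  preserved and reflected by the injection \<open>f \<mapsto> x f\<close> on exponents.
\<close>

lemma laurent_binomials_eq:
  "laurent_binomials = {q :: ('a::field, 'n::finite) laurent. card (Poly_Mapping.keys q) \<le> 2}"
proof (intro Set.equalityI subsetI CollectI)
  fix q :: "('a, 'n) laurent" assume "q \<in> laurent_binomials"
  then obtain a g b h where q: "q = laurent_term a g + laurent_term b h"
    by (auto simp: laurent_binomials_def)
  have "Poly_Mapping.keys q \<subseteq> {g, h}"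
    by (auto simp: q in_keys_iff lookup_add lookup_single when_def split: if_splits)
  then have "card (Poly_Mapping.keys q) \<le> card {g, h}" by (simp add: card_mono)
  also have "\<dots> \<le> 2" by (simp add: card_insert_if)
  finally show "card (Poly_Mapping.keys q) \<le> 2" .
next
  fix q :: "('a, 'n) laurent" assume "q \<in> {q. card (Poly_Mapping.keys q) \<le> 2}"
  then consider "card (Poly_Mapping.keys q) = 0" | "card (Poly_Mapping.keys q) = 1"
    | "card (Poly_Mapping.keys q) = 2" by fastforce
  then have "\<exists>a g b h. q = laurent_term a g + laurent_term b h"
  proof cases
    case 1
    then have "q = laurent_term 0 0 + laurent_term 0 0" by simp
    then show ?thesis by blast
  next
    case 2
    then obtain g where "Poly_Mapping.keys q = {g}" by (auto simp: card_1_singleton_iff)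
    then have "q = laurent_term (Poly_Mapping.lookup q g) g + laurent_term 0 0"
      by (subst laurent_eq_sum_terms) simp
    then show ?thesis by blast
  next
    case 3
    then obtain g h where "Poly_Mapping.keys q = {g, h}" "g \<noteq> h" by (auto simp: card_2_iff)
    then have "q = laurent_term (Poly_Mapping.lookup q g) g + laurent_term (Poly_Mapping.lookup q h) h"
      by (subst laurent_eq_sum_terms) simp
    then show ?thesis by blast
  qed
  then show "q \<in> laurent_binomials"
    by (auto simp: laurent_binomials_def)
qed

text \<open>
  One step of Gaussian elimination. If some admissible binomial \<open>b\<close> involves \<open>Y\<^sup>t\<close>, subtracting
  from any other such binomial the multiple of \<open>b\<close> that cancels its \<open>Y\<^sup>t\<close>-term leaves at most one
  exponent of each of the two, hence again a binomial of \<open>V\<close>. An element in which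
  \<open>Y\<^sup>t\<close> has coefficient zero is not changed by this subtraction.
\<close>

lemma eliminate_exponent:
  fixes V :: "('a::field, 'n::finite) laurent set"
  assumes V: "laurent.subspace V"
    and r: "r \<in> laurent.span {q \<in> laurent_binomials \<inter> V. Poly_Mapping.keys q \<subseteq> insert t T}"
    and rt: "Poly_Mapping.lookup r t = 0"
  shows "r \<in> laurent.span {q \<in> laurent_binomials \<inter> V. Poly_Mapping.keys q \<subseteq> T}"
    (is "r \<in> laurent.span ?B")
proof (cases "\<exists>b\<in>laurent_binomials \<inter> V. Poly_Mapping.keys b \<subseteq> insert t T \<and> t \<in> Poly_Mapping.keys b")
  case False
  then have "{q \<in> laurent_binomials \<inter> V. Poly_Mapping.keys q \<subseteq> insert t T} = ?B" by blast
  with r show ?thesis by simp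
next
  case True
  then obtain b where b: "b \<in> laurent_binomials" "b \<in> V" "Poly_Mapping.keys b \<subseteq> insert t T"
    and tb: "t \<in> Poly_Mapping.keys b" by blast
  define pivot where
    "pivot q = laurent_const (Poly_Mapping.lookup q t / Poly_Mapping.lookup b t) * b"
    for q :: "('a, 'n) laurent"
  have "r - pivot r \<in> laurent.span ?B"
    using r
  proof (induction rule: laurent.span_induct)
    case base
    have add: "pivot (p + q) = pivot p + pivot q" for p q
      by (simp add: pivot_def lookup_add add_divide_distrib single_add distrib_right)
    have scale: "pivot (laurent_const c * p) = laurent_const c * pivot p" for c p
      by (simp add: pivot_def mult_single mult.assoc[symmetric])
    show ?case
    proof (rule laurent.subspaceI)
      show "0 \<in> {q. q - pivot q \<in> laurent.span ?B}"
        by (simp add: pivot_def laurent.span_zero)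
    next
      fix p q assume "p \<in> {q. q - pivot q \<in> laurent.span ?B}" "q \<in> {q. q - pivot q \<in> laurent.span ?B}"
      then have "(p - pivot p) + (q - pivot q) \<in> laurent.span ?B"
        by (intro laurent.span_add) auto
      then show "p + q \<in> {q. q - pivot q \<in> laurent.span ?B}"
        by (simp add: add algebra_simps)
    next
      fix c p assume "p \<in> {q. q - pivot q \<in> laurent.span ?B}"
      then have "laurent_const c * (p - pivot p) \<in> laurent.span ?B"
        by (intro laurent.span_scale) auto
      then show "laurent_const c * p \<in> {q. q - pivot q \<in> laurent.span ?B}"
        by (simp add: scale right_diff_distrib)
    qed
  next
    case (step q)
    show ?case
    proof (cases "t \<in> Poly_Mapping.keys q")
      case False
      then have "pivot q = 0" by (simp add: pivot_def in_keys_iff)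
      with False step show ?thesis by (intro laurent.span_base) auto
    next
      case True
      have keys: "Poly_Mapping.keys (q - pivot q)
          \<subseteq> (Poly_Mapping.keys q - {t}) \<union> (Poly_Mapping.keys b - {t})"
        using tb by (auto simp: in_keys_iff pivot_def lookup_minus)
      then have "card (Poly_Mapping.keys (q - pivot q))
          \<le> card ((Poly_Mapping.keys q - {t}) \<union> (Poly_Mapping.keys b - {t}))"
        by (intro card_mono) auto
      also have "\<dots> \<le> card (Poly_Mapping.keys q - {t}) + card (Poly_Mapping.keys b - {t})"
        by (rule card_Un_le)
      also have "\<dots> \<le> 2"
        using step b True tb by (auto simp: laurent_binomials_eq)
      finally have "q - pivot q \<in> laurent_binomials" by (simp add: laurent_binomials_eq)
      moreover have "q - pivot q \<in> V"
        unfolding pivot_def using V step b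
        by (intro laurent.subspace_diff laurent.subspace_scale) auto
      moreover have "Poly_Mapping.keys (q - pivot q) \<subseteq> T"
        using keys step b by blast
      ultimately show ?thesis by (intro laurent.span_base) auto
    qed
  qed
  with rt show ?thesis by (simp add: pivot_def)
qed

text \<open>
  A combination of binomials involves only finitely many exponents, so those outside \<open>S\<close> can
  be eliminated in finitely many steps.
\<close>

lemma span_binomials_supported:
  fixes V :: "('a::field, 'n::finite) laurent set"
  assumes V: "laurent.subspace V"
    and r: "r \<in> laurent.span (laurent_binomials \<inter> V)"
    and keys: "Poly_Mapping.keys r \<subseteq> S"
  shows "r \<in> laurent.span {q \<in> laurent_binomials \<inter> V. Poly_Mapping.keys q \<subseteq> S}"
proof -
  let ?B = "\<lambda>T. {q \<in> laurent_binomials \<inter> V. Poly_Mapping.keys q \<subseteq> T}"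
  obtain A c where A: "finite A" "A \<subseteq> laurent_binomials \<inter> V" "r = (\<Sum>a\<in>A. laurent_const (c a) * a)"
    using r unfolding laurent.span_explicit by blast
  define U where "U = (\<Union>a\<in>A. Poly_Mapping.keys a) - S"
  have "r \<in> laurent.span (?B (U \<union> S))"
    unfolding A(3) using A(2)
    by (intro laurent.span_sum laurent.span_scale laurent.span_base) (auto simp: U_def)
  moreover have "finite U" "U \<inter> S = {}" using A(1) by (auto simp: U_def)
  moreover have "r \<in> laurent.span (?B S)" if "finite U" "U \<inter> S = {}" "r \<in> laurent.span (?B (U \<union> S))" for U
    using that
  proof (induction rule: finite_induct)
    case (insert t U)
    have "r \<in> laurent.span (?B (U \<union> S))"
    proof (rule eliminate_exponent[OF V])
      show "r \<in> laurent.span (?B (insert t (U \<union> S)))" using insert.prems by simp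
      show "Poly_Mapping.lookup r t = 0"
        using insert.prems keys by (auto simp: in_keys_iff)
    qed
    with insert show ?case by auto
  qed simp
  ultimately show ?thesis by blast
qed

section \<open>The endomorphism of the Laurent ring\<close>

context difference_field
begin

lemma keys_laurent_sigma:
  "Poly_Mapping.keys (laurent_sigma \<sigma> p) = (*s) xvar ` Poly_Mapping.keys p"
proof
  show "Poly_Mapping.keys (laurent_sigma \<sigma> p) \<subseteq> (*s) xvar ` Poly_Mapping.keys p"
    unfolding laurent_sigma_def by (rule order_trans[OF keys_sum]) (auto split: if_splits)
  show "(*s) xvar ` Poly_Mapping.keys p \<subseteq> Poly_Mapping.keys (laurent_sigma \<sigma> p)"
    by (auto simp: in_keys_iff lookup_laurent_sigma sigma_eq_0_iff)
qed

lemma laurent_sigma_add: "laurent_sigma \<sigma> (p + q) = laurent_sigma \<sigma> p + laurent_sigma \<sigma> q"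
proof (rule poly_mapping_eqI)
  fix f
  show "Poly_Mapping.lookup (laurent_sigma \<sigma> (p + q)) f
      = Poly_Mapping.lookup (laurent_sigma \<sigma> p + laurent_sigma \<sigma> q) f"
  proof (cases "f \<in> range ((*s) xvar)")
    case True
    then show ?thesis by (auto simp: lookup_laurent_sigma lookup_add sigma_add)
  next
    case False
    then have "Poly_Mapping.lookup (laurent_sigma \<sigma> s) f = 0" for s
    proof -
      have "f \<notin> Poly_Mapping.keys (laurent_sigma \<sigma> s)"
        using False unfolding keys_laurent_sigma by blast
      then show ?thesis by (simp add: in_keys_iff)
    qed
    then show ?thesis by (simp add: lookup_add)
  qed
qed

lemma laurent_sigma_mult: "laurent_sigma \<sigma> (p * q) = laurent_sigma \<sigma> p * laurent_sigma \<sigma> q"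
proof (induction p rule: laurent_induct)
  case (monomial a f)
  show ?case
    by (induction q rule: laurent_induct)
      (simp_all add: mult_single laurent_sigma_term sigma_mult laurent_sigma_add vector_add_ldistrib
        distrib_left)
qed (simp add: laurent_sigma_add distrib_right)

lemma laurent_sigma_zero: "laurent_sigma \<sigma> 0 = 0"
  by (simp add: laurent_sigma_def)

lemma laurent_sigma_inj: "laurent_sigma \<sigma> p = laurent_sigma \<sigma> q \<Longrightarrow> p = q"
proof -
  assume eq: "laurent_sigma \<sigma> p = laurent_sigma \<sigma> q"
  have "laurent_sigma \<sigma> (p - q) + laurent_sigma \<sigma> q = laurent_sigma \<sigma> p"
    by (simp flip: laurent_sigma_add)
  with eq have "Poly_Mapping.keys (laurent_sigma \<sigma> (p - q)) = {}" by simp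
  then show "p = q" by (simp add: keys_laurent_sigma)
qed

lemma laurent_sigma_binomial_iff:
  "laurent_sigma \<sigma> q \<in> laurent_binomials \<longleftrightarrow> q \<in> laurent_binomials"
  by (simp add: laurent_binomials_eq keys_laurent_sigma card_image inj_on_def xvar_smult_inj)

lemma laurent_sigma_const_mult:
  "laurent_sigma \<sigma> (laurent_const c * p) = laurent_const (\<sigma> c) * laurent_sigma \<sigma> p"
  by (simp add: laurent_sigma_mult laurent_sigma_term)

lemma laurent_sigma_funpow_add:
  "(laurent_sigma \<sigma> ^^ k) (p + q) = (laurent_sigma \<sigma> ^^ k) p + (laurent_sigma \<sigma> ^^ k) q"
  by (induction k) (simp_all add: laurent_sigma_add)

lemma laurent_sigma_funpow_mult:
  "(laurent_sigma \<sigma> ^^ k) (p * q) = (laurent_sigma \<sigma> ^^ k) p * (laurent_sigma \<sigma> ^^ k) q"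
  by (induction k) (simp_all add: laurent_sigma_mult)

lemma laurent_sigma_funpow_term:
  "(laurent_sigma \<sigma> ^^ k) (laurent_term a f) = laurent_term ((\<sigma> ^^ k) a) (xvar ^ k *s f)"
  by (induction k) (simp_all add: laurent_sigma_term vector_smult_assoc)

lemma sigma_funpow_eq_0_iff: "(\<sigma> ^^ k) a = 0 \<longleftrightarrow> a = 0"
  by (induction k) (simp_all add: sigma_eq_0_iff)

lemma laurent_sigma_funpow_binomial:
  "(laurent_sigma \<sigma> ^^ k) (laurent_term 1 f - laurent_const c)
    = laurent_term 1 (xvar ^ k *s f) - laurent_const ((\<sigma> ^^ k) c)"
proof -
  have one: "(\<sigma> ^^ k) 1 = 1" by (induction k) (simp_all add: sigma_one)
  have "(laurent_sigma \<sigma> ^^ k) (laurent_term 1 f - laurent_const c)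
      + (laurent_sigma \<sigma> ^^ k) (laurent_const c) = laurent_term 1 (xvar ^ k *s f)"
    unfolding laurent_sigma_funpow_add[symmetric] by (simp add: laurent_sigma_funpow_term one)
  then show ?thesis by (simp add: laurent_sigma_funpow_term eq_diff_eq)
qed

section \<open>Binomial ideals are spanned by their binomials\<close>

text \<open>
  The span of the binomials in \<open>I\<close> is already a \<open>\<sigma>\<close>-ideal: the product of a term and a
  binomial of \<open>I\<close>, as well as the \<open>\<sigma>\<close>-image of a binomial of \<open>I\<close>, is a binomial of \<open>I\<close>. Since
  it contains the generators, it contains \<open>I\<close>.
\<close>

lemma binomial_sigma_ideal_spanned:
  fixes I :: "('a, 'n::finite) laurent set"
  assumes "laurent_binomial_sigma_ideal \<sigma> I"
  shows "I \<subseteq> laurent.span (laurent_binomials \<inter> I)"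
proof -
  obtain B where B: "B \<subseteq> laurent_binomials" and I: "I = sigma_ideal \<sigma> hull B"
    using assms by (auto simp: laurent_binomial_sigma_ideal_def)
  have ideal: "sigma_ideal \<sigma> I" unfolding I by (rule sigma_ideal_hull)
  let ?S = "laurent.span (laurent_binomials \<inter> I)"
  have term_mult: "laurent_term a f * p \<in> ?S" if "p \<in> ?S" for a f p
    using that
  proof (induction rule: laurent.span_induct)
    case base
    show ?case
      by (rule laurent.subspaceI)
        (auto simp: distrib_left mult.left_commute laurent.span_zero intro: laurent.span_add laurent.span_scale)
  next
    case (step p)
    then have "laurent_term a f * p \<in> I"
      using ideal module.subspace_scale[OF module_mult] unfolding sigma_ideal_def by blast
    moreover have "laurent_term a f * p \<in> laurent_binomials"
    proof -
      obtain b g c h where "p = laurent_term b g + laurent_term c h"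
        using step by (auto simp: laurent_binomials_def)
      then have "laurent_term a f * p = laurent_term (a * b) (f + g) + laurent_term (a * c) (f + h)"
        by (simp add: distrib_left mult_single)
      then show ?thesis unfolding laurent_binomials_def by blast
    qed
    ultimately show ?case by (intro laurent.span_base) blast
  qed
  have "q * p \<in> ?S" if "p \<in> ?S" for p q
    by (induction q rule: laurent_induct)
      (simp_all add: term_mult that distrib_right laurent.span_add)
  then have "module.subspace (*) ?S"
    by (intro module.subspaceI[OF module_mult] laurent.span_add laurent.span_zero)
  moreover have "laurent_sigma \<sigma> p \<in> ?S" if "p \<in> ?S" for p
    using that
  proof (induction rule: laurent.span_induct)
    case base
    show ?case
      by (rule laurent.subspaceI)
        (auto simp: laurent_sigma_add laurent_sigma_const_mult laurent_sigma_zero laurent.span_zero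
          intro: laurent.span_add laurent.span_scale)
  next
    case (step p)
    with ideal have "laurent_sigma \<sigma> p \<in> laurent_binomials \<inter> I"
      by (auto simp: laurent_sigma_binomial_iff sigma_ideal_def)
    then show ?case by (rule laurent.span_base)
  qed
  ultimately have "sigma_ideal \<sigma> ?S" by (simp add: sigma_ideal_def)
  moreover have "B \<subseteq> ?S"
    using B hull_subset[of B "sigma_ideal \<sigma>"] unfolding I by (auto intro: laurent.span_base)
  ultimately show ?thesis
    by (subst I) (rule hull_minimal)
qed

section \<open>The reflexive closure\<close>

text \<open>
  Two elements of the right-hand side may come with different powers of \<open>\<sigma>\<close>; since \<open>I\<close> is
  closed under \<open>\<sigma>\<close>, a common larger power serves for both.
\<close>

lemma reflexive_closure_eq:
  fixes I :: "('a, 'n::finite) laurent set"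
  assumes I: "sigma_ideal \<sigma> I"
  shows "reflexive_closure \<sigma> I = {p. \<exists>k. (laurent_sigma \<sigma> ^^ k) p \<in> I}" (is "_ = ?J")
  unfolding reflexive_closure_def
proof (rule hull_unique)
  show "I \<subseteq> ?J" by (auto intro: exI[of _ 0])
next
  fix T assume T: "I \<subseteq> T" "reflexive_sigma_ideal \<sigma> T"
  have "p \<in> T" if "(laurent_sigma \<sigma> ^^ k) p \<in> I" for p k
    using that
  proof (induction k arbitrary: p)
    case (Suc k)
    then have "laurent_sigma \<sigma> p \<in> T" by (simp add: funpow_swap1)
    with T show ?case by (auto simp: reflexive_sigma_ideal_def)
  qed (use T in auto)
  then show "?J \<subseteq> T" by blast
next
  have step: "laurent_sigma \<sigma> p \<in> I" if "p \<in> I" for p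
    using I that by (auto simp: sigma_ideal_def)
  have mono: "(laurent_sigma \<sigma> ^^ (j + k)) p \<in> I" if "(laurent_sigma \<sigma> ^^ k) p \<in> I" for j k p
    using that by (induction j) (simp_all add: step)
  have sub: "module.subspace (*) I" using I by (simp add: sigma_ideal_def)
  have "module.subspace (*) ?J"
  proof (rule module.subspaceI[OF module_mult])
    show "0 \<in> ?J" using module.subspace_0[OF module_mult sub] by (auto intro: exI[of _ 0])
  next
    fix p q assume "p \<in> ?J" "q \<in> ?J"
    then obtain j k where "(laurent_sigma \<sigma> ^^ j) p \<in> I" "(laurent_sigma \<sigma> ^^ k) q \<in> I" by blast
    then have "(laurent_sigma \<sigma> ^^ (j + k)) p \<in> I" "(laurent_sigma \<sigma> ^^ (j + k)) q \<in> I"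
      using mono[of j p k] mono[of k q j] by (simp_all only: add.commute)
    then have "(laurent_sigma \<sigma> ^^ (j + k)) (p + q) \<in> I"
      unfolding laurent_sigma_funpow_add by (rule module.subspace_add[OF module_mult sub])
    then show "p + q \<in> ?J" by blast
  next
    fix c p assume "p \<in> ?J"
    then obtain k where "(laurent_sigma \<sigma> ^^ k) p \<in> I" by blast
    then have "(laurent_sigma \<sigma> ^^ k) (c * p) \<in> I"
      unfolding laurent_sigma_funpow_mult by (rule module.subspace_scale[OF module_mult sub])
    then show "c * p \<in> ?J" by blast
  qed
  moreover have "laurent_sigma \<sigma> p \<in> ?J" if "p \<in> ?J" for p
  proof -
    from that obtain k where "(laurent_sigma \<sigma> ^^ k) p \<in> I" by blast
    then have "(laurent_sigma \<sigma> ^^ k) (laurent_sigma \<sigma> p) \<in> I"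
      unfolding funpow_swap1[symmetric] by (rule step)
    then show ?thesis by blast
  qed
  moreover have "p \<in> ?J" if "laurent_sigma \<sigma> p \<in> ?J" for p
  proof -
    from that obtain k where "(laurent_sigma \<sigma> ^^ k) (laurent_sigma \<sigma> p) \<in> I" by blast
    then have "(laurent_sigma \<sigma> ^^ Suc k) p \<in> I" by (simp add: funpow_swap1)
    then show ?thesis by blast
  qed
  ultimately show "reflexive_sigma_ideal \<sigma> ?J"
    unfolding reflexive_sigma_ideal_def sigma_ideal_def by blast
qed

lemma subspace_vimage_laurent_sigma:
  "laurent.subspace V \<Longrightarrow> laurent.subspace (laurent_sigma \<sigma> -` V)"
  unfolding laurent.subspace_def
  by (simp add: laurent_sigma_zero laurent_sigma_add laurent_sigma_const_mult)

end

context inversive_difference_field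
begin

lemma sigma_inverse: "\<sigma> (inv \<sigma> a) = a"
  by (rule surj_f_inv_f) (rule bij_is_surj[OF bij_sigma])

text \<open>
  This is where surjectivity on the coefficients enters: the exponents are divisible by \<open>x\<close>
  by assumption, and each coefficient has a preimage because the field is inversive.
\<close>

lemma laurent_sigma_onto:
  assumes "Poly_Mapping.keys r \<subseteq> range ((*s) xvar)"
  shows "\<exists>p. laurent_sigma \<sigma> p = r"
proof -
  have "\<exists>p. laurent_sigma \<sigma> p = (\<Sum>f\<in>A. laurent_term (Poly_Mapping.lookup r f) f)"
    if "finite A" "A \<subseteq> range ((*s) xvar)" for A
    using that
  proof induction
    case empty
    show ?case using laurent_sigma_zero by auto
  next
    case (insert f A)
    then obtain p g where p: "laurent_sigma \<sigma> p = (\<Sum>f\<in>A. laurent_term (Poly_Mapping.lookup r f) f)"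
      and f: "f = xvar *s g" by blast
    have "laurent_sigma \<sigma> (laurent_term (inv \<sigma> (Poly_Mapping.lookup r f)) g + p)
        = (\<Sum>f\<in>insert f A. laurent_term (Poly_Mapping.lookup r f) f)"
      using insert.hyps by (simp add: laurent_sigma_add laurent_sigma_term sigma_inverse p flip: f)
    then show ?case by blast
  qed
  from this[of "Poly_Mapping.keys r"] assms show ?thesis
    by (simp flip: laurent_eq_sum_terms)
qed

text \<open>
  For \<open>\<sigma>(p) \<in> V\<close>, write \<open>\<sigma>(p)\<close> in terms of binomials of \<open>V\<close> with exponents divisible by \<open>x\<close>,
  pull each of them back along \<open>\<sigma>\<close>, and compare with \<open>p\<close> by injectivity.
\<close>

lemma vimage_laurent_sigma_spanned:
  fixes V :: "('a, 'n::finite) laurent set"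
  assumes V: "laurent.subspace V" and spanned: "V \<subseteq> laurent.span (laurent_binomials \<inter> V)"
  shows "laurent_sigma \<sigma> -` V \<subseteq> laurent.span (laurent_binomials \<inter> laurent_sigma \<sigma> -` V)"
proof
  let ?S = "laurent.span (laurent_binomials \<inter> laurent_sigma \<sigma> -` V)"
  fix p assume "p \<in> laurent_sigma \<sigma> -` V"
  with spanned have "laurent_sigma \<sigma> p \<in> laurent.span (laurent_binomials \<inter> V)" by blast
  moreover have "Poly_Mapping.keys (laurent_sigma \<sigma> p) \<subseteq> range ((*s) xvar)"
    by (auto simp: keys_laurent_sigma)
  ultimately have
    "laurent_sigma \<sigma> p \<in> laurent.span {q \<in> laurent_binomials \<inter> V. Poly_Mapping.keys q \<subseteq> range ((*s) xvar)}"
    by (rule span_binomials_supported[OF V])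
  then have "laurent_sigma \<sigma> p \<in> laurent_sigma \<sigma> ` ?S"
  proof (induction rule: laurent.span_induct)
    case base
    show ?case
    proof (rule laurent.subspaceI)
      show "0 \<in> {r. r \<in> laurent_sigma \<sigma> ` ?S}"
        using laurent_sigma_zero laurent.span_zero by (auto intro!: image_eqI[of _ _ 0])
    next
      fix r s assume "r \<in> {r. r \<in> laurent_sigma \<sigma> ` ?S}" "s \<in> {r. r \<in> laurent_sigma \<sigma> ` ?S}"
      then show "r + s \<in> {r. r \<in> laurent_sigma \<sigma> ` ?S}"
        by (auto simp flip: laurent_sigma_add intro: laurent.span_add)
    next
      fix c r assume "r \<in> {r. r \<in> laurent_sigma \<sigma> ` ?S}"
      then obtain q where q: "q \<in> ?S" "r = laurent_sigma \<sigma> q" by blast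
      then have "laurent_const c * r = laurent_sigma \<sigma> (laurent_const (inv \<sigma> c) * q)"
        by (simp add: laurent_sigma_const_mult sigma_inverse)
      with q show "laurent_const c * r \<in> {r. r \<in> laurent_sigma \<sigma> ` ?S}"
        by (auto intro: laurent.span_scale)
    qed
  next
    case (step r)
    then obtain q where r: "r = laurent_sigma \<sigma> q" using laurent_sigma_onto by blast
    with step have "q \<in> laurent_binomials \<inter> laurent_sigma \<sigma> -` V"
      by (simp add: laurent_sigma_binomial_iff)
    then have "q \<in> ?S" by (rule laurent.span_base)
    with r show ?case by blast
  qed
  then show "p \<in> ?S" using laurent_sigma_inj by blast
qed

text \<open>
  Induction on \<open>k\<close> shows that each preimage of \<open>I\<close> under \<open>\<sigma>\<^sup>k\<close> is spanned by its binomials. All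
  of these binomials lie in the closure, so they generate it as a \<open>\<sigma>\<close>-ideal.
\<close>

lemma reflexive_closure_binomial:
  fixes I :: "('a, 'n::finite) laurent set"
  assumes I: "laurent_binomial_sigma_ideal \<sigma> I"
  shows "laurent_binomial_sigma_ideal \<sigma> (reflexive_closure \<sigma> I)"
proof -
  let ?R = "reflexive_closure \<sigma> I"
  have ideal: "sigma_ideal \<sigma> I"
    using I sigma_ideal_hull by (auto simp: laurent_binomial_sigma_ideal_def)
  let ?V = "\<lambda>k. (laurent_sigma \<sigma> ^^ k) -` I"
  have R: "?R = (\<Union>k. ?V k)"
    by (auto simp: reflexive_closure_eq[OF ideal])
  have V: "laurent.subspace (?V k) \<and> ?V k \<subseteq> laurent.span (laurent_binomials \<inter> ?V k)" for k
  proof (induction k)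
    case 0
    show ?case
      using sigma_ideal_subspace[OF ideal] binomial_sigma_ideal_spanned[OF I] by simp
  next
    case (Suc k)
    have "?V (Suc k) = laurent_sigma \<sigma> -` ?V k" by (auto simp: funpow_swap1)
    with Suc show ?case
      using subspace_vimage_laurent_sigma vimage_laurent_sigma_spanned by metis
  qed
  let ?H = "sigma_ideal \<sigma> hull (laurent_binomials \<inter> ?R)"
  have "laurent.subspace ?H" by (rule sigma_ideal_subspace[OF sigma_ideal_hull])
  then have "laurent.span (laurent_binomials \<inter> ?V k) \<subseteq> ?H" for k
    by (intro laurent.span_minimal order_trans[OF _ hull_subset]) (auto simp: R)
  then have "?R \<subseteq> ?H" unfolding R using V by blast
  moreover have "?H \<subseteq> ?R"
    using reflexive_sigma_ideal_closure[of \<sigma> I]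
    by (intro hull_minimal) (auto simp: reflexive_sigma_ideal_def)
  ultimately show ?thesis
    by (auto simp: laurent_binomial_sigma_ideal_def)
qed

lemma support_lattice_reflexive_closure:
  fixes I :: "('a, 'n::finite) laurent set"
  assumes I: "sigma_ideal \<sigma> I"
  shows "support_lattice (reflexive_closure \<sigma> I) = sat_x (support_lattice I)"
proof -
  have surj: "surj (\<sigma> ^^ k)" for k
    by (rule bij_is_surj[OF bij_fn[OF bij_sigma]])
  have "f \<in> support_lattice (reflexive_closure \<sigma> I) \<longleftrightarrow> f \<in> sat_x (support_lattice I)" for f
  proof
    assume "f \<in> support_lattice (reflexive_closure \<sigma> I)"
    then obtain c k where c: "c \<noteq> 0"
      and "(laurent_sigma \<sigma> ^^ k) (laurent_term 1 f - laurent_const c) \<in> I"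
      unfolding support_lattice_def reflexive_closure_eq[OF I] by blast
    then have "laurent_term 1 (xvar ^ k *s f) - laurent_const ((\<sigma> ^^ k) c) \<in> I"
      by (simp only: laurent_sigma_funpow_binomial)
    moreover have "(\<sigma> ^^ k) c \<noteq> 0" using c by (simp only: sigma_funpow_eq_0_iff not_False_eq_True)
    ultimately show "f \<in> sat_x (support_lattice I)"
      unfolding sat_x_def support_lattice_def by blast
  next
    assume "f \<in> sat_x (support_lattice I)"
    then obtain d k where d: "d \<noteq> 0" and I': "laurent_term 1 (xvar ^ k *s f) - laurent_const d \<in> I"
      unfolding sat_x_def support_lattice_def by blast
    obtain c where c: "d = (\<sigma> ^^ k) c" using surjD[OF surj] by blast
    have "(laurent_sigma \<sigma> ^^ k) (laurent_term 1 f - laurent_const c) \<in> I"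
      using I' unfolding c laurent_sigma_funpow_binomial .
    moreover have "c \<noteq> 0" using d unfolding c sigma_funpow_eq_0_iff .
    ultimately show "f \<in> support_lattice (reflexive_closure \<sigma> I)"
      unfolding support_lattice_def reflexive_closure_eq[OF I] by blast
  qed
  then show ?thesis by blast
qed

end

theorem theorem4p26:
  fixes \<sigma> :: "'a::field_char_0 \<Rightarrow> 'a"
    and I :: "('a, 'n::finite) laurent set"
  assumes "inversive_difference_field \<sigma>"
    and "laurent_binomial_sigma_ideal \<sigma> I"
  shows "laurent_binomial_sigma_ideal \<sigma> (reflexive_closure \<sigma> I)
    \<and> support_lattice (reflexive_closure \<sigma> I) = sat_x (support_lattice I)"
proof -
  interpret inversive_difference_field \<sigma> by fact
  have "sigma_ideal \<sigma> I"
    using assms(2) sigma_ideal_hull by (auto simp: laurent_binomial_sigma_ideal_def)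
  then show ?thesis
    using reflexive_closure_binomial[OF assms(2)] support_lattice_reflexive_closure by blast
qed

end
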